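(* Let $p\in(0,1)$ and $$W_\tau^{'L}=c_5+c_6\,(\boldsymbol{\mu}-r\mathbf{1})^\top\mathbf{x}-c_7\,(\mathbf{x}^\top\mathbf{\Sigma}\,\mathbf{x})+c_8\,\frac{\Lambda}{\sigma_\Lambda}\sqrt{\mathbf{x}^\top\mathbf{\Sigma}\,\mathbf{x}}.$$ Then $$CVaR_{1-p}(-W_\tau^{'L})=-c_5-c_6\,(\boldsymbol{\mu}-r\mathbf{1})^\top\mathbf{x}+c_7\,(\mathbf{x}^\top\mathbf{\Sigma}\,\mathbf{x})+c_9\sqrt{\mathbf{x}^\top\mathbf{\Sigma}\,\mathbf{x}},$$ where $$c_9=c_8\,\frac{1}{p\sqrt{2\pi}}\,e^{-\frac12(\Phi^{-1}(p))^2}$$ and $\Phi$ is the standard normal distribution function.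
   Context: Risk measures: for a random variable $X$ with distribution function $F_X$, $VaR_p(X)=\inf\{x\in\mathbb{R}: F_X(x)\ge p\}$ and $CVaR_p(X)=\mathbb{E}(X\mid X>VaR_p(X))$. $\tau$ is a positive integer; $\alpha_0,\dots,\alpha_{\tau-1}\ge0$ are endowments, not all zero; $r>0$; $\mathbf{x}\in\mathbb{R}^m$ is a fixed vector of fractions of wealth in $m$ risky assets; $\mathbf{1}=(1,\dots,1)^\top$; $B'_1,\dots,B'_m$ are jointly Gaussian standard Brownian motions with $\mathrm{Cov}(B'_i(t),B'_j(t+s))=t\rho_{i,j}$ for $t,s\ge0$; $\sigma_j>0$ are volatilities; $\mathbf{\Sigma}=(\sigma_i\sigma_j\rho_{i,j})_{i,j}$ with $\mathbf{x}^\top\mathbf{\Sigma}\mathbf{x}>0$; $B_{\mathbf{x}}(t)=\frac{1}{\mathbf{x}^\top\mathbf{\Sigma}\mathbf{x}}\sum_jx_j\sigma_jB'_j(t)$; $V_t=(\mathbf{x}^\top\mathbf{\Sigma}\mathbf{x})(B_{\mathbf{x}}(\tau)-B_{\mathbf{x}}(t))$; $\Lambda=\sum_{t=0}^{\tau-1}\alpha_tV_t$ with standard deviation $\sigma_\Lambda$. $\lambda,\lambda_j$ are jump intensities, $Z_{k,j,\ell}$ ($\ell=0,1$) are real random jump magnitudes, $h_{j,\ell}=\mathbb{E}[e^{Z_{k,j,\ell}}]-1$, $\mu_j\in\mathbb{R}$ are drifts, $\boldsymbol{\mu}=(r+\mu_1-\lambda h_{1,0}-\lambda_1h_{1,1},\dots,r+\mu_m-\lambda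 h_{m,0}-\lambda_mh_{m,1})^\top$, $Z^\star_{k,j,\ell}(\mathbf{x})$ is defined by $e^{Z^\star_{k,j,\ell}(\mathbf{x})}-1=x_j(e^{Z_{k,j,\ell}}-1)$, and $M_Z(\theta)=\mathbb{E}(e^{\theta Z})$. The (deterministic) constants are $$c_{2,t}=(\tau-t)r+\lambda(\tau-t)\Big(\prod_{j=1}^{m}M_{Z^\star_{1,j,0}(\mathbf{x})}(1)-1\Big)+\sum_{j=1}^{m}\lambda_j(\tau-t)\Big(M_{Z^\star_{1,j,1}(\mathbf{x})}(1)-1\Big),$$ $$c_5=\sum_{t=0}^{\tau-1}\alpha_t(1+c_{2,t}),\qquad c_6=\sum_{t=0}^{\tau-1}\alpha_t(\tau-t),$$ $$c_7=\sum_{t=0}^{\tau-1}\alpha_t\frac{\big(\sum_{l=0}^{\tau-1}\alpha_l\min\{\tau-t,\tau-l\}\big)^2}{2\sum_{k,l=0}^{\tau-1}\alpha_k\alpha_l\min\{\tau-k,\tau-l\}},\qquad c_8=\sum_{t=0}^{\tau-1}\alpha_t\frac{\sum_{l=0}^{\tau-1}\alpha_l\min\{\tau-t,\tau-l\}}{\sqrt{\sum_{k,l=0}^{\tau-1}\alpha_k\alpha_l\min\{\tau-k,\tau-l\}}}.$$ *)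

theory Defs
  imports "HOL-Probability.Probability"
begin

definition VaR :: "'a measure \<Rightarrow> real \<Rightarrow> ('a \<Rightarrow> real) \<Rightarrow> real" where
  "VaR M p X = Inf {x. p \<le> cdf (distr M borel X) x}"

text \<open>The elementary conditional expectation of \<open>X\<close> given the event \<open>A\<close>
  (meaningful if \<open>A\<close> has positive probability).\<close>

definition expectation_given :: "'a measure \<Rightarrow> ('a \<Rightarrow> real) \<Rightarrow> 'a set \<Rightarrow> real" where
  "expectation_given M X A = (LINT \<omega>:A|M. X \<omega>) / measure M A"

definition CVaR :: "'a measure \<Rightarrow> real \<Rightarrow> ('a \<Rightarrow> real) \<Rightarrow> real" where
  "CVaR M p X = expectation_given M X {\<omega> \<in> space M. X \<omega> > VaR M p X}"

definition Phi :: "real \<Rightarrow> real" where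
  "Phi = cdf std_normal_distribution"

definition covariance :: "'a measure \<Rightarrow> ('a \<Rightarrow> real) \<Rightarrow> ('a \<Rightarrow> real) \<Rightarrow> real" where
  "covariance M X Y =
     (LINT \<omega>|M. (X \<omega> - (LINT \<omega>'|M. X \<omega>')) * (Y \<omega> - (LINT \<omega>'|M. Y \<omega>')))"

definition std_dev :: "'a measure \<Rightarrow> ('a \<Rightarrow> real) \<Rightarrow> real" where
  "std_dev M X = sqrt (prob_space.variance M X)"

text \<open>The degenerate (almost surely constant) case counts as Gaussian.\<close>

definition gaussian :: "'a measure \<Rightarrow> ('a \<Rightarrow> real) \<Rightarrow> bool" where
  "gaussian M X \<longleftrightarrow> X \<in> borel_measurable M \<and>
     ((\<exists>c. AE \<omega> in M. X \<omega> = c) \<or>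
      (\<exists>m s. s > 0 \<and> distributed M lborel X (normal_density m s)))"

definition jointly_gaussian :: "'a measure \<Rightarrow> ('i \<Rightarrow> 'a \<Rightarrow> real) \<Rightarrow> 'i set \<Rightarrow> bool" where
  "jointly_gaussian M X I \<longleftrightarrow>
     (\<forall>J a. finite J \<and> J \<subseteq> I \<longrightarrow> gaussian M (\<lambda>\<omega>. \<Sum>i\<in>J. a i * X i \<omega>))"

definition standard_brownian_motion :: "'a measure \<Rightarrow> (real \<Rightarrow> 'a \<Rightarrow> real) \<Rightarrow> bool" where
  "standard_brownian_motion M B \<longleftrightarrow>
     (\<forall>t\<ge>0. B t \<in> borel_measurable M) \<and>
     (AE \<omega> in M. B 0 \<omega> = 0) \<and>
     (AE \<omega> in M. continuous_on {0..} (\<lambda>t. B t \<omega>)) \<and>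
     (\<forall>s t. 0 \<le> s \<and> s < t \<longrightarrow>
        distributed M lborel (\<lambda>\<omega>. B t \<omega> - B s \<omega>) (normal_density 0 (sqrt (t - s)))) \<and>
     (\<forall>n (t :: nat \<Rightarrow> real). 0 \<le> t 0 \<and> strict_mono t \<longrightarrow>
        prob_space.indep_vars M (\<lambda>_. borel) (\<lambda>i \<omega>. B (t (Suc i)) \<omega> - B (t i) \<omega>) {..<n})"

definition mgf :: "'a measure \<Rightarrow> ('a \<Rightarrow> real) \<Rightarrow> real \<Rightarrow> real" where
  "mgf M Z \<theta> = (LINT \<omega>|M. exp (\<theta> * Z \<omega>))"

text \<open>Assets are indexed by the finite type \<open>'m\<close>. Subscripts that range over \<open>0, 1\<close>
  (common and idiosyncratic jumps) are natural numbers: \<open>Z k j l\<close> stands for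
  $Z_{k,j,\ell}$ and \<open>h j l\<close> for $h_{j,\ell}$. The intensity of the common jumps is \<open>lam0\<close>,
  those of the idiosyncratic jumps are \<open>lam $ j\<close>. The values \<open>\<alpha> t\<close> are used only for
  \<open>t < \<tau>\<close>.\<close>

definition Sigma_mat :: "real^'m \<Rightarrow> real^'m^'m \<Rightarrow> real^'m^'m" where
  "Sigma_mat \<sigma> \<rho> = (\<chi> i j. \<sigma> $ i * \<sigma> $ j * \<rho> $ i $ j)"

definition drift_vec ::
  "real \<Rightarrow> real^'m \<Rightarrow> real \<Rightarrow> real^'m \<Rightarrow> ('m \<Rightarrow> nat \<Rightarrow> real) \<Rightarrow> real^'m" where
  "drift_vec r \<mu> lam0 lam h = (\<chi> j. r + \<mu> $ j - lam0 * h j 0 - lam $ j * h j 1)"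

text \<open>The factor is the reciprocal of the variance rate, not of its square root, so this is
  not a standard Brownian motion in general; the factor cancels in \<open>V_portfolio\<close>.\<close>

definition B_portfolio ::
  "real^'m::finite \<Rightarrow> real^'m \<Rightarrow> real^'m^'m \<Rightarrow> ('m \<Rightarrow> real \<Rightarrow> 'a \<Rightarrow> real) \<Rightarrow> real \<Rightarrow> 'a \<Rightarrow> real" where
  "B_portfolio x \<sigma> \<rho> B t \<omega> =
     1 / (x \<bullet> (Sigma_mat \<sigma> \<rho> *v x)) * (\<Sum>j\<in>UNIV. x $ j * \<sigma> $ j * B j t \<omega>)"

definition V_portfolio ::
  "nat \<Rightarrow> real^'m::finite \<Rightarrow> real^'m \<Rightarrow> real^'m^'m \<Rightarrow> ('m \<Rightarrow> real \<Rightarrow> 'a \<Rightarrow> real) \<Rightarrow> nat \<Rightarrow> 'a \<Rightarrow> real"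
where
  "V_portfolio \<tau> x \<sigma> \<rho> B t \<omega> =
     (x \<bullet> (Sigma_mat \<sigma> \<rho> *v x))
       * (B_portfolio x \<sigma> \<rho> B (real \<tau>) \<omega> - B_portfolio x \<sigma> \<rho> B (real t) \<omega>)"

definition Lambda_cond ::
  "nat \<Rightarrow> (nat \<Rightarrow> real) \<Rightarrow> real^'m::finite \<Rightarrow> real^'m \<Rightarrow> real^'m^'m
     \<Rightarrow> ('m \<Rightarrow> real \<Rightarrow> 'a \<Rightarrow> real) \<Rightarrow> 'a \<Rightarrow> real" where
  "Lambda_cond \<tau> \<alpha> x \<sigma> \<rho> B \<omega> = (\<Sum>t<\<tau>. \<alpha> t * V_portfolio \<tau> x \<sigma> \<rho> B t \<omega>)"

text \<open>\<open>Zs k j l\<close> stands for $Z^\star_{k,j,\ell}(\mathbf{x})$.\<close>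

definition c2 ::
  "'a measure \<Rightarrow> nat \<Rightarrow> real \<Rightarrow> real \<Rightarrow> real^'m::finite
     \<Rightarrow> (nat \<Rightarrow> 'm \<Rightarrow> nat \<Rightarrow> 'a \<Rightarrow> real) \<Rightarrow> nat \<Rightarrow> real" where
  "c2 M \<tau> r lam0 lam Zs t =
     (real \<tau> - real t) * r
     + lam0 * (real \<tau> - real t) * ((\<Prod>j\<in>UNIV. mgf M (Zs 1 j 0) 1) - 1)
     + (\<Sum>j\<in>UNIV. lam $ j * (real \<tau> - real t) * (mgf M (Zs 1 j 1) 1 - 1))"

definition c5 ::
  "'a measure \<Rightarrow> nat \<Rightarrow> (nat \<Rightarrow> real) \<Rightarrow> real \<Rightarrow> real \<Rightarrow> real^'m::finite
     \<Rightarrow> (nat \<Rightarrow> 'm \<Rightarrow> nat \<Rightarrow> 'a \<Rightarrow> real) \<Rightarrow> real" where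
  "c5 M \<tau> \<alpha> r lam0 lam Zs = (\<Sum>t<\<tau>. \<alpha> t * (1 + c2 M \<tau> r lam0 lam Zs t))"

definition c6 :: "nat \<Rightarrow> (nat \<Rightarrow> real) \<Rightarrow> real" where
  "c6 \<tau> \<alpha> = (\<Sum>t<\<tau>. \<alpha> t * (real \<tau> - real t))"

definition c7 :: "nat \<Rightarrow> (nat \<Rightarrow> real) \<Rightarrow> real" where
  "c7 \<tau> \<alpha> =
     (\<Sum>t<\<tau>. \<alpha> t *
        ((\<Sum>l<\<tau>. \<alpha> l * min (real \<tau> - real t) (real \<tau> - real l))\<^sup>2
         / (2 * (\<Sum>k<\<tau>. \<Sum>l<\<tau>. \<alpha> k * \<alpha> l * min (real \<tau> - real k) (real \<tau> - real l)))))"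

definition c8 :: "nat \<Rightarrow> (nat \<Rightarrow> real) \<Rightarrow> real" where
  "c8 \<tau> \<alpha> =
     (\<Sum>t<\<tau>. \<alpha> t *
        ((\<Sum>l<\<tau>. \<alpha> l * min (real \<tau> - real t) (real \<tau> - real l))
         / sqrt (\<Sum>k<\<tau>. \<Sum>l<\<tau>. \<alpha> k * \<alpha> l * min (real \<tau> - real k) (real \<tau> - real l))))"

definition c9 :: "nat \<Rightarrow> (nat \<Rightarrow> real) \<Rightarrow> real \<Rightarrow> real" where
  "c9 \<tau> \<alpha> p = c8 \<tau> \<alpha> * (1 / (p * sqrt (2 * pi))) * exp (- (1/2) * (inv Phi p)\<^sup>2)"

definition W_L ::
  "'a measure \<Rightarrow> nat \<Rightarrow> (nat \<Rightarrow> real) \<Rightarrow> real \<Rightarrow> real^'m::finite \<Rightarrow> real^'m \<Rightarrow> real^'m \<Rightarrow> real^'m^'m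
     \<Rightarrow> real \<Rightarrow> real^'m \<Rightarrow> ('m \<Rightarrow> nat \<Rightarrow> real) \<Rightarrow> (nat \<Rightarrow> 'm \<Rightarrow> nat \<Rightarrow> 'a \<Rightarrow> real)
     \<Rightarrow> ('m \<Rightarrow> real \<Rightarrow> 'a \<Rightarrow> real) \<Rightarrow> 'a \<Rightarrow> real" where
  "W_L M \<tau> \<alpha> r \<mu> x \<sigma> \<rho> lam0 lam h Zs B \<omega> =
     c5 M \<tau> \<alpha> r lam0 lam Zs
     + c6 \<tau> \<alpha> * ((drift_vec r \<mu> lam0 lam h - r *\<^sub>R 1) \<bullet> x)
     - c7 \<tau> \<alpha> * (x \<bullet> (Sigma_mat \<sigma> \<rho> *v x))
     + c8 \<tau> \<alpha> * (Lambda_cond \<tau> \<alpha> x \<sigma> \<rho> B \<omega> / std_dev M (Lambda_cond \<tau> \<alpha> x \<sigma> \<rho> B))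
         * sqrt (x \<bullet> (Sigma_mat \<sigma> \<rho> *v x))"

end

theory Submission
  imports Defs "HOL-Real_Asymp.Real_Asymp"
begin

text \<open>
  Since \<open>-W\<close> is an affine function of $\Lambda / \sigma_\Lambda$, it suffices that this quotient is
  standard normal. Joint Gaussianity makes $\Lambda$ Gaussian or constant, its mean is \<open>0\<close>, and its
  variance is $\mathbf{x}^\top\mathbf{\Sigma}\mathbf{x}$ times
  $\sum_{k,l}\alpha_k\alpha_l\min\{\tau-k,\tau-l\} > 0$. The constant \<open>c9\<close> then
  comes from $\int_z^\infty u\,\varphi(u)\,du = \varphi(z)$, for \<open>\<phi>\<close> the standard normal density,
  at $z = \Phi^{-1}(1-p) = -\Phi^{-1}(p)$.
\<close>

section \<open>The standard normal distribution function and its inverse\<close>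

lemma distributed_std_normal_id:
  "distributed std_normal_distribution lborel (\<lambda>x. x) std_normal_density"
  unfolding distributed_def by (auto simp: distr_id2)

lemma std_normal_prob_le:
  assumes "distributed M lborel X (\<lambda>x. ennreal (std_normal_density x))"
  shows "measure M {\<omega> \<in> space M. X \<omega> \<le> z} = Phi z"
proof -
  have "Phi z = measure (distr M lborel X) {..z}"
    using distributed_distr_eq_density[OF assms] by (simp add: Phi_def cdf_def)
  also have "\<dots> = measure M {\<omega> \<in> space M. X \<omega> \<le> z}"
    using distributed_measurable[OF assms]
    by (subst measure_distr) (auto intro!: arg_cong[where f = "measure M"])
  finally show ?thesis ..
qed

text \<open>A distribution function is continuous exactly where there is no atom, and a law with a
  Lebesgue density has none. Both forms are used: continuity for the intermediate value theorem,
  absence of atoms for the reflection formula.\<close>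

lemma isCont_Phi: "isCont Phi z"
proof -
  interpret real_distribution std_normal_distribution by (rule real_dist_normal_dist)
  have "emeasure std_normal_distribution {z} = 0"
    by (simp add: emeasure_density nn_integral_cmult_indicator)
  then show ?thesis
    unfolding Phi_def isCont_cdf by (simp add: measure_def)
qed

text \<open>The density is positive everywhere, so an interval of mass zero would be Lebesgue null.
  Strictness allows \<open>Phi\<close> to be cancelled, both for quantiles and in the set that
  defines \<open>VaR\<close>.\<close>

lemma Phi_strict_mono: "strict_mono Phi"
proof (rule strict_monoI)
  interpret real_distribution std_normal_distribution by (rule real_dist_normal_dist)
  fix a b :: real
  assume ab: "a < b"
  have "emeasure std_normal_distribution {a<..b} \<noteq> 0"
  proof
    assume "emeasure std_normal_distribution {a<..b} = 0"
    then have "AE x in lborel. x \<notin> {a<..b}"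
      by (simp add: emeasure_density nn_integral_0_iff_AE indicator_eq_0_iff
        ennreal_eq_0_iff not_le[THEN iffD2, OF normal_density_pos])
    then have "emeasure lborel {a<..b} = 0"
      by (subst (asm) AE_iff_measurable[of "{a<..b}"]) auto
    with ab show False by simp
  qed
  then have "0 < measure std_normal_distribution {a<..b}"
    by (simp add: emeasure_eq_measure order_less_le)
  then show "Phi a < Phi b"
    using cdf_diff_eq[OF ab] by (simp add: Phi_def)
qed

text \<open>\<open>inv\<close> is specified by choice and is informative only on the range of
  \<open>Phi\<close>. The limits 0 and 1 at the two infinities bracket \<open>p\<close>, and the
  intermediate value theorem places it in the range.\<close>

lemma Phi_inv:
  assumes "0 < p" "p < 1"
  shows "Phi (inv Phi p) = p"
proof -
  interpret real_distribution std_normal_distribution by (rule real_dist_normal_dist)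
  obtain a where a: "Phi a < p"
    using order_tendstoD(2)[OF cdf_lim_at_bot assms(1)]
    unfolding Phi_def eventually_at_bot_linorder by blast
  obtain b where b: "p < Phi b"
    using order_tendstoD(1)[OF cdf_lim_at_top_prob assms(2)]
    unfolding Phi_def eventually_at_top_linorder by blast
  have "a \<le> b"
    using a b strict_mono_less_eq[OF Phi_strict_mono, of a b] by simp
  then have "p \<in> range Phi"
    using IVT[of Phi a p b] a b isCont_Phi by auto
  then show ?thesis
    by (rule f_inv_into_f)
qed

lemma Phi_minus: "Phi (- z) = 1 - Phi z"
proof -
  interpret real_distribution std_normal_distribution by (rule real_dist_normal_dist)
  \<comment> \<open>Negation is the affine map of slope -1, written so as to match the affine rule;
    the density is even, so the law is unchanged.\<close>
  have "distributed std_normal_distribution lborel (\<lambda>x. 0 + - 1 * x)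
      (\<lambda>x. ennreal (normal_density (0 + - 1 * 0) (\<bar>- 1\<bar> * 1) x))"
    by (rule normal_density_affine[OF distributed_std_normal_id]) auto
  then have D: "distributed std_normal_distribution lborel (\<lambda>x. - x)
      (\<lambda>x. ennreal (std_normal_density x))"
    by simp
  \<comment> \<open>Reflection yields the closed half-line from \<open>z\<close>, whereas the
    complement of \<open>{..z}\<close> is the open one; they differ by a null point.\<close>
  have "measure std_normal_distribution {z} = 0"
    using isCont_Phi[of z] unfolding Phi_def isCont_cdf .
  moreover have "measure std_normal_distribution {z..}
      = measure std_normal_distribution {z} + measure std_normal_distribution {z<..}"
    by (subst finite_measure_Union[symmetric]) (auto intro!: arg_cong[where f = prob])
  moreover have "measure std_normal_distribution {z<..} = 1 - Phi z"
    unfolding Phi_def cdf_def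
    by (subst prob_compl[symmetric]) (auto intro!: arg_cong[where f = prob])
  moreover have "Phi (- z) = measure std_normal_distribution {z..}"
    using std_normal_prob_le[OF D, of "- z"] by (simp add: atLeast_def)
  ultimately show ?thesis by simp
qed

text \<open>Reconciles the level \<open>1 - p\<close> of the risk measure with the quantile at
  \<open>p\<close> in \<open>c9\<close>, where squaring removes the sign.\<close>

lemma inv_Phi_one_minus:
  assumes "0 < p" "p < 1"
  shows "inv Phi (1 - p) = - inv Phi p"
proof -
  have "Phi (inv Phi (1 - p)) = Phi (- inv Phi p)"
    using assms by (simp add: Phi_inv Phi_minus)
  then show ?thesis
    using strict_mono_eq[OF Phi_strict_mono] by blast
qed

section \<open>Tail expectation of a normal variable\<close>

lemma std_normal_tail_moment:
  "(LINT x|lborel. std_normal_density x * (x * indicator {z<..} x)) = std_normal_density z"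
proof -
  \<comment> \<open>The negated density is an antiderivative of the integrand; 0 is its limit at
    infinity.\<close>
  have "(LBINT x=ereal z..\<infinity>. std_normal_density x * x) = 0 - (- std_normal_density z)"
  proof (rule interval_integral_FTC_integrable)
    show "((\<lambda>x. - std_normal_density x) has_vector_derivative std_normal_density x * x) (at x)" for x
      unfolding has_real_derivative_iff_has_vector_derivative[symmetric] std_normal_density_def
      by (auto intro!: derivative_eq_intros simp: power2_eq_square field_simps)
    show "isCont (\<lambda>x. std_normal_density x * x) x" for x
      unfolding std_normal_density_def by (intro continuous_intros) auto
    show "set_integrable lborel (einterval (ereal z) \<infinity>) (\<lambda>x. std_normal_density x * x)"
      unfolding set_integrable_def
      using integrable_mult_indicator[OF _ integrable_std_normal_moment[of 1], of "einterval (ereal z) \<infinity>"]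
      by simp
    have "((\<lambda>x. - std_normal_density x) \<longlongrightarrow> - std_normal_density z) (at_right z)"
      unfolding std_normal_density_def by (intro tendsto_intros) auto
    then show "(((\<lambda>x. - std_normal_density x) \<circ> real_of_ereal) \<longlongrightarrow> - std_normal_density z) (at_right (ereal z))"
      by (simp add: ereal_tendsto_simps)
    have "((\<lambda>x. - std_normal_density x) \<longlongrightarrow> 0) at_top"
      unfolding std_normal_density_def by real_asymp
    then show "(((\<lambda>x. - std_normal_density x) \<circ> real_of_ereal) \<longlongrightarrow> 0) (at_left \<infinity>)"
      by (simp add: ereal_tendsto_simps)
  qed simp
  then show ?thesis
    by (simp add: interval_lebesgue_integral_def set_lebesgue_integral_def einterval_def
      greaterThan_def mult_ac)
qed

text \<open>Standardising to \<open>X = a + b * N\<close> turns the event beyond \<open>VaR\<close>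
  into \<open>N > z\<close>, which has probability \<open>p\<close>. Dividing the integral of
  \<open>X\<close> over it, \<open>a * p + b * std_normal_density z\<close>, by \<open>p\<close>
  gives the formula.\<close>

lemma CVaR_normal:
  assumes "prob_space M" and b: "b > 0"
    and D: "distributed M lborel X (normal_density a b)"
    and p: "0 < p" "p < 1"
  shows "CVaR M (1 - p) X = a + b * (1 / (p * sqrt (2 * pi)) * exp (- (1/2) * (inv Phi p)\<^sup>2))"
proof -
  interpret prob_space M by fact
  define N where "N = (\<lambda>\<omega>. (X \<omega> - a) / b)"
  define z where "z = inv Phi (1 - p)"
  have X: "X = (\<lambda>\<omega>. a + b * N \<omega>)"
    using b by (simp add: N_def)
  have DN: "distributed M lborel N (\<lambda>x. ennreal (std_normal_density x))"
    using D unfolding N_def normal_standard_normal_convert[OF b] .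
  have N[measurable]: "N \<in> borel_measurable M"
    using distributed_measurable[OF DN] by simp
  have Phi_z: "Phi z = 1 - p"
    unfolding z_def using p by (intro Phi_inv) auto
  have "cdf (distr M borel X) y = Phi ((y - a) / b)" for y
  proof -
    have "cdf (distr M borel X) y = prob {\<omega> \<in> space M. X \<omega> \<le> y}"
      unfolding cdf_def X
      by (subst measure_distr) (auto intro!: arg_cong[where f = prob])
    also have "\<dots> = prob {\<omega> \<in> space M. N \<omega> \<le> (y - a) / b}"
      using b by (simp add: X field_simps)
    finally show ?thesis
      using std_normal_prob_le[OF DN] by simp
  qed
  \<comment> \<open>With the level written as \<open>Phi z\<close>, monotonicity cancels
    \<open>Phi\<close>; what remains is a closed half-line, whose infimum is its endpoint.\<close>
  then have "{y. 1 - p \<le> cdf (distr M borel X) y} = {y. Phi z \<le> Phi ((y - a) / b)}"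
    by (simp add: Phi_z)
  also have "\<dots> = {a + b * z..}"
    using b by (auto simp: strict_mono_less_eq[OF Phi_strict_mono] field_simps)
  finally have "VaR M (1 - p) X = a + b * z"
    by (simp add: VaR_def)
  then have event: "{\<omega> \<in> space M. X \<omega> > VaR M (1 - p) X} = {\<omega> \<in> space M. N \<omega> > z}" (is "_ = ?A")
    using b by (simp add: X)
  have "?A = space M - {\<omega> \<in> space M. N \<omega> \<le> z}" by auto
  then have prob_A: "prob ?A = p"
    using std_normal_prob_le[OF DN, of z] Phi_z by (simp add: prob_compl)
  have "integrable lborel (\<lambda>x. std_normal_density x * x)"
    using integrable_std_normal_moment[of 1] by simp
  then have iN: "integrable M N"
    using distributed_integrable[OF DN, of "\<lambda>x. x"] by simp
  have "(LINT \<omega>|M. N \<omega> * indicator {z<..} (N \<omega>)) = std_normal_density z"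
    using distributed_integral[OF DN, of "\<lambda>x. x * indicator {z<..} x"] std_normal_tail_moment[of z]
    by simp
  then have "(LINT \<omega>:?A|M. N \<omega>) = std_normal_density z"
    unfolding set_lebesgue_integral_def
    by (subst Bochner_Integration.integral_cong[OF refl,
        where g = "\<lambda>\<omega>. N \<omega> * indicator {z<..} (N \<omega>)"]) (auto simp: indicator_def)
  moreover have "(LINT \<omega>:?A|M. X \<omega>) = a * p + b * (LINT \<omega>:?A|M. N \<omega>)"
  proof -
    have "(LINT \<omega>:?A|M. X \<omega>) = (LINT \<omega>:?A|M. a) + (LINT \<omega>:?A|M. b * N \<omega>)"
      unfolding X using iN
      by (intro set_integral_add)
        (auto simp: set_integrable_def emeasure_eq_measure
          intro!: integrable_mult_indicator[where 'b = real, simplified])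
    then show ?thesis
      by (simp add: set_lebesgue_integral_def prob_A mult.left_commute[of _ b])
  qed
  ultimately have "CVaR M (1 - p) X = (a * p + b * std_normal_density z) / p"
    unfolding CVaR_def expectation_given_def event by (simp add: prob_A)
  moreover have "std_normal_density z = 1 / sqrt (2 * pi) * exp (- (1/2) * (inv Phi p)\<^sup>2)"
    unfolding z_def inv_Phi_one_minus[OF p] std_normal_density_def by simp
  ultimately show ?thesis
    using p by (simp add: field_simps)
qed

section \<open>Second moments of weighted sums of Brownian increments\<close>

lemma brownian_moments:
  assumes "prob_space M" "standard_brownian_motion M B" "t \<ge> 0"
  shows "integrable M (\<lambda>\<omega>. (B t \<omega>)\<^sup>2)" "(LINT \<omega>|M. B t \<omega>) = 0"
proof -
  interpret prob_space M by fact
  have B0: "AE \<omega> in M. B 0 \<omega> = 0" and [measurable]: "B 0 \<in> borel_measurable M" "B t \<in> borel_measurable M"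
    using assms unfolding standard_brownian_motion_def by auto
  \<comment> \<open>Brownian motion is specified through the laws of increments over nonempty
    intervals, and starts at 0 only almost surely. Hence the detour through
    \<open>B t - B 0\<close>, with \<open>t = 0\<close> as a separate trivial case and a transfer
    along almost sure equality.\<close>
  have "integrable M (\<lambda>\<omega>. (B t \<omega> - B 0 \<omega>)\<^sup>2) \<and> (LINT \<omega>|M. B t \<omega> - B 0 \<omega>) = 0"
  proof (cases "t = 0")
    case False
    with assms(3) have t: "0 < t" by simp
    have "\<forall>s t. 0 \<le> s \<and> s < t \<longrightarrow>
        distributed M lborel (\<lambda>\<omega>. B t \<omega> - B s \<omega>) (normal_density 0 (sqrt (t - s)))"
      using assms(2) unfolding standard_brownian_motion_def by blast
    from this[rule_format, of 0 t] t
    have D: "distributed M lborel (\<lambda>\<omega>. B t \<omega> - B 0 \<omega>) (normal_density 0 (sqrt t))"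
      by simp
    have "integrable lborel (\<lambda>x. normal_density 0 (sqrt t) x * x\<^sup>2)"
      using integrable_normal_moment[of "sqrt t" 0 2] t by simp
    then show ?thesis
      using distributed_integrable[OF D, of "\<lambda>x. x\<^sup>2"] normal_distributed_expectation[OF _ D] t by simp
  qed simp
  moreover have "integrable M (\<lambda>\<omega>. (B t \<omega> - B 0 \<omega>)\<^sup>2) \<longleftrightarrow> integrable M (\<lambda>\<omega>. (B t \<omega>)\<^sup>2)"
    using B0 by (intro integrable_cong_AE) auto
  moreover have "(LINT \<omega>|M. B t \<omega> - B 0 \<omega>) = (LINT \<omega>|M. B t \<omega>)"
    using B0 by (intro integral_cong_AE) auto
  ultimately show "integrable M (\<lambda>\<omega>. (B t \<omega>)\<^sup>2)" "(LINT \<omega>|M. B t \<omega>) = 0"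
    by auto
qed

text \<open>The sum of the squares dominates the product. This justifies expanding expectations of
  products of Brownian sums term by term.\<close>

lemma square_integrable_imp_integrable_mult:
  fixes f g :: "'a \<Rightarrow> real"
  assumes [measurable]: "f \<in> borel_measurable M" "g \<in> borel_measurable M"
    and "integrable M (\<lambda>x. (f x)\<^sup>2)" "integrable M (\<lambda>x. (g x)\<^sup>2)"
  shows "integrable M (\<lambda>x. f x * g x)"
proof (rule Bochner_Integration.integrable_bound)
  show "integrable M (\<lambda>x. (f x)\<^sup>2 + (g x)\<^sup>2)"
    using assms by simp
  have "\<bar>a * b\<bar> \<le> \<bar>a\<^sup>2 + b\<^sup>2\<bar>" for a b :: real
  proof -
    have "2 * (\<bar>a\<bar> * \<bar>b\<bar>) \<le> a\<^sup>2 + b\<^sup>2" "0 \<le> \<bar>a\<bar> * \<bar>b\<bar>"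
      using sum_squares_bound[of "\<bar>a\<bar>" "\<bar>b\<bar>"] by simp_all
    then show ?thesis unfolding abs_mult by linarith
  qed
  then show "AE x in M. norm (f x * g x) \<le> norm ((f x)\<^sup>2 + (g x)\<^sup>2)"
    by simp
qed simp

text \<open>The square is a double sum over pairs of increments, so the kernel
  \<open>q * min s t\<close> determines its expectation.\<close>

lemma expectation_sum_increments_squared:
  fixes Y :: "real \<Rightarrow> 'a \<Rightarrow> real"
  assumes i: "\<And>s t. 0 \<le> s \<Longrightarrow> 0 \<le> t \<Longrightarrow> integrable M (\<lambda>\<omega>. Y s \<omega> * Y t \<omega>)"
    and e: "\<And>s t. 0 \<le> s \<Longrightarrow> 0 \<le> t \<Longrightarrow> (LINT \<omega>|M. Y s \<omega> * Y t \<omega>) = q * min s t"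
  shows "(LINT \<omega>|M. (\<Sum>t<\<tau>. \<alpha> t * (Y (real \<tau>) \<omega> - Y (real t) \<omega>))\<^sup>2)
    = q * (\<Sum>k<\<tau>. \<Sum>l<\<tau>. \<alpha> k * \<alpha> l * min (real \<tau> - real k) (real \<tau> - real l))"
proof -
  let ?T = "real \<tau>"
  let ?f = "\<lambda>k l \<omega>. \<alpha> k * \<alpha> l * (Y ?T \<omega> * Y ?T \<omega> - Y ?T \<omega> * Y (real l) \<omega>
      - Y (real k) \<omega> * Y ?T \<omega> + Y (real k) \<omega> * Y (real l) \<omega>)"
  have int: "integrable M (?f k l)" for k l
    using i by simp
  have "(LINT \<omega>|M. (\<Sum>t<\<tau>. \<alpha> t * (Y ?T \<omega> - Y (real t) \<omega>))\<^sup>2)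
      = (LINT \<omega>|M. (\<Sum>k<\<tau>. \<Sum>l<\<tau>. ?f k l \<omega>))"
    by (simp add: power2_eq_square sum_product algebra_simps)
  also have "\<dots> = (\<Sum>k<\<tau>. \<Sum>l<\<tau>. integral\<^sup>L M (?f k l))"
    using int by simp
  also have "\<dots> = (\<Sum>k<\<tau>. \<Sum>l<\<tau>. q * (\<alpha> k * \<alpha> l * min (?T - real k) (?T - real l)))"
  proof (intro sum.cong refl)
    fix k l assume "k \<in> {..<\<tau>}" "l \<in> {..<\<tau>}"
    \<comment> \<open>As \<open>k\<close> and \<open>l\<close> lie below \<tau>, the left side is
      \<tau> - l - k + min k l, that is, \<tau> minus the larger of the two.\<close>
    then have eq: "?T - min ?T (real l) - min (real k) ?T + min (real k) (real l)
        = min (?T - real k) (?T - real l)"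
      by auto
    have "integral\<^sup>L M (?f k l) = \<alpha> k * \<alpha> l * (q * ?T - q * min ?T (real l)
        - q * min (real k) ?T + q * min (real k) (real l))"
      using i e by simp
    also have "\<dots> = q * (\<alpha> k * \<alpha> l *
        (?T - min ?T (real l) - min (real k) ?T + min (real k) (real l)))"
      by (simp only: algebra_simps)
    finally show "integral\<^sup>L M (?f k l) = q * (\<alpha> k * \<alpha> l * min (?T - real k) (?T - real l))"
      unfolding eq .
  qed
  finally show ?thesis
    by (simp add: sum_distrib_left)
qed

lemma min_kernel_pos:
  fixes \<alpha> :: "nat \<Rightarrow> real"
  assumes "\<And>t. t < \<tau> \<Longrightarrow> \<alpha> t \<ge> 0" "\<exists>t<\<tau>. \<alpha> t \<noteq> 0"
  shows "0 < (\<Sum>k<\<tau>. \<Sum>l<\<tau>. \<alpha> k * \<alpha> l * min (real \<tau> - real k) (real \<tau> - real l))"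
proof -
  obtain t where t: "t < \<tau>" "0 < \<alpha> t"
    using assms by (metis order_less_le)
  have nonneg: "0 \<le> \<alpha> k * \<alpha> l * min (real \<tau> - real k) (real \<tau> - real l)" if "k < \<tau>" "l < \<tau>" for k l
    using that assms(1) by simp
  \<comment> \<open>All terms are nonnegative, and the diagonal term at \<open>t\<close> is positive
    because \<open>t\<close> lies below \<tau>.\<close>
  show ?thesis
    using t by (intro sum_pos2[of _ t] sum_nonneg) (auto intro!: nonneg sum_pos2[of _ t])
qed

text \<open>The numerators of \<open>c8\<close>, weighted by \<alpha>, add up to the very double sum
  under the root, so \<open>c8\<close> is the square root of a positive number. This gives the
  positive scale that \<open>CVaR_normal\<close> asks for.\<close>

lemma c8_pos:
  assumes "\<And>t. t < \<tau> \<Longrightarrow> \<alpha> t \<ge> 0" "\<exists>t<\<tau>. \<alpha> t \<noteq> 0"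
  shows "0 < c8 \<tau> \<alpha>"
proof -
  let ?D = "\<Sum>k<\<tau>. \<Sum>l<\<tau>. \<alpha> k * \<alpha> l * min (real \<tau> - real k) (real \<tau> - real l)"
  have "c8 \<tau> \<alpha> = ?D / sqrt ?D"
    by (simp add: c8_def sum_divide_distrib sum_distrib_left mult.assoc)
  then show ?thesis
    using min_kernel_pos[of \<tau> \<alpha>] assms by simp
qed

section \<open>Normality of the standardised \<open>Lambda_cond\<close>\<close>

lemma gaussian_standardized:
  assumes "prob_space M" "gaussian M X" "(LINT \<omega>|M. X \<omega>) = 0" "(LINT \<omega>|M. (X \<omega>)\<^sup>2) \<noteq> 0"
  shows "distributed M lborel (\<lambda>\<omega>. X \<omega> / std_dev M X) (\<lambda>x. ennreal (std_normal_density x))"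
proof -
  interpret prob_space M by fact
  have [measurable]: "X \<in> borel_measurable M"
    using assms(2) by (simp add: gaussian_def)
  \<comment> \<open>\<open>gaussian\<close> admits constants. A constant of mean 0 would be 0,
    contradicting the nonzero second moment.\<close>
  have "\<nexists>c. AE \<omega> in M. X \<omega> = c"
  proof
    assume "\<exists>c. AE \<omega> in M. X \<omega> = c"
    then obtain c where c: "AE \<omega> in M. X \<omega> = c" ..
    have "expectation X = expectation (\<lambda>_. c)"
      using c by (intro integral_cong_AE) auto
    with assms(3) have "c = 0" by (simp add: prob_space)
    then have "(LINT \<omega>|M. (X \<omega>)\<^sup>2) = expectation (\<lambda>_. 0)"
      using c by (intro integral_cong_AE) auto
    with assms(4) show False by simp
  qed
  then obtain m s where s: "s > 0" and D: "distributed M lborel X (normal_density m s)"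
    using assms(2) by (auto simp: gaussian_def)
  have "m = 0"
    using normal_distributed_expectation[OF s D] assms(3) by simp
  moreover have "std_dev M X = s"
    using normal_distributed_variance[OF s D] s by (simp add: std_dev_def)
  ultimately show ?thesis
    using D normal_standard_normal_convert[OF s, of X m] by simp
qed

text \<open>Joint Gaussianity speaks of one finite sum over pairs of an asset and a time. Collecting
  the coefficient of each value \<open>B j s\<close> brings the sum of increments into that
  form.\<close>

lemma jointly_gaussian_sum_increments:
  fixes B :: "'m::finite \<Rightarrow> real \<Rightarrow> 'a \<Rightarrow> real"
  assumes "jointly_gaussian M (\<lambda>(j, t). B j t) (UNIV \<times> {0..})"
  shows "gaussian M (\<lambda>\<omega>. \<Sum>t<\<tau>. \<alpha> t * ((\<Sum>j\<in>UNIV. c j * B j (real \<tau>) \<omega>) - (\<Sum>j\<in>UNIV. c j * B j (real t) \<omega>)))"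
proof -
  \<comment> \<open>The terminal time occurs in every increment and collects all weights; each
    earlier time occurs once, with a minus sign. Times are real here, so the floor recovers the
    index of \<alpha>.\<close>
  define a where "a = (\<lambda>(j, s). c j * (if s = real \<tau> then (\<Sum>t<\<tau>. \<alpha> t) else - \<alpha> (nat \<lfloor>s\<rfloor>)))"
  have "(\<Sum>i\<in>UNIV \<times> real ` {..\<tau>}. a i * (case i of (j, t) \<Rightarrow> B j t) \<omega>)
      = (\<Sum>t<\<tau>. \<alpha> t * ((\<Sum>j\<in>UNIV. c j * B j (real \<tau>) \<omega>) - (\<Sum>j\<in>UNIV. c j * B j (real t) \<omega>)))" for \<omega>
  proof -
    have "(\<Sum>i\<in>UNIV \<times> real ` {..\<tau>}. a i * (case i of (j, t) \<Rightarrow> B j t) \<omega>)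
        = (\<Sum>j\<in>UNIV. \<Sum>t\<le>\<tau>. a (j, real t) * B j (real t) \<omega>)"
      by (simp add: sum.cartesian_product' sum.reindex)
    also have "\<dots> = (\<Sum>j\<in>UNIV. \<Sum>t<\<tau>. \<alpha> t * (c j * B j (real \<tau>) \<omega> - c j * B j (real t) \<omega>))"
      by (simp add: a_def lessThan_Suc_atMost[symmetric] sum_subtractf right_diff_distrib
        sum_distrib_left sum_distrib_right sum_negf mult_ac)
    also have "\<dots> = (\<Sum>t<\<tau>. \<Sum>j\<in>UNIV. \<alpha> t * (c j * B j (real \<tau>) \<omega> - c j * B j (real t) \<omega>))"
      by (rule sum.swap)
    finally show ?thesis
      by (simp add: sum_distrib_left sum_subtractf right_diff_distrib)
  qed
  moreover have "finite ((UNIV :: 'm set) \<times> real ` {..\<tau>})" "(UNIV :: 'm set) \<times> real ` {..\<tau>} \<subseteq> UNIV \<times> {0..}"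
    by auto
  ultimately show ?thesis
    using assms unfolding jointly_gaussian_def by (metis (no_types, lifting) ext)
qed

lemma Lambda_cond_standardized:
  fixes B :: "'m::finite \<Rightarrow> real \<Rightarrow> 'a \<Rightarrow> real"
  assumes "prob_space M"
    and \<alpha>: "\<And>t. t < \<tau> \<Longrightarrow> \<alpha> t \<ge> 0" "\<exists>t<\<tau>. \<alpha> t \<noteq> 0"
    and bm: "\<And>j. standard_brownian_motion M (B j)"
    and jg: "jointly_gaussian M (\<lambda>(j, t). B j t) (UNIV \<times> {0..})"
    and cov: "\<And>i j s t. 0 \<le> s \<Longrightarrow> 0 \<le> t \<Longrightarrow> covariance M (B i t) (B j (t + s)) = t * \<rho> $ i $ j"
    and q: "x \<bullet> (Sigma_mat \<sigma> \<rho> *v x) > 0"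
  shows "distributed M lborel
    (\<lambda>\<omega>. Lambda_cond \<tau> \<alpha> x \<sigma> \<rho> B \<omega> / std_dev M (Lambda_cond \<tau> \<alpha> x \<sigma> \<rho> B))
    (\<lambda>x. ennreal (std_normal_density x))"
proof -
  interpret prob_space M by fact
  let ?q = "x \<bullet> (Sigma_mat \<sigma> \<rho> *v x)"
  \<comment> \<open>The positive variance rate in \<open>V_portfolio\<close> cancels its reciprocal
    in \<open>B_portfolio\<close>, leaving this process.\<close>
  define Y where "Y t \<omega> = (\<Sum>j\<in>UNIV. x $ j * \<sigma> $ j * B j t \<omega>)" for t \<omega>
  have Lambda: "Lambda_cond \<tau> \<alpha> x \<sigma> \<rho> B = (\<lambda>\<omega>. \<Sum>t<\<tau>. \<alpha> t * (Y (real \<tau>) \<omega> - Y (real t) \<omega>))"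
    using q by (simp add: fun_eq_iff Lambda_cond_def V_portfolio_def B_portfolio_def Y_def
      right_diff_distrib)
  have meas: "B j t \<in> borel_measurable M" if "0 \<le> t" for j t
    using bm[of j] that by (simp add: standard_brownian_motion_def)
  note B2 = brownian_moments[OF \<open>prob_space M\<close> bm]
  have prod: "integrable M (\<lambda>\<omega>. B i s \<omega> * B j t \<omega>)" if "0 \<le> s" "0 \<le> t" for i j s t
    using that by (intro square_integrable_imp_integrable_mult meas B2)
  have iB: "integrable M (B j t)" if "0 \<le> t" for j t
    using square_integrable_imp_integrable[OF meas[OF that] B2(1)[OF that]] .
  have cov': "(LINT \<omega>|M. B i t \<omega> * B j (t + s) \<omega>) = t * \<rho> $ i $ j" if "0 \<le> s" "0 \<le> t" for i j s t
    using cov[OF that, of i j] that by (simp add: covariance_def B2)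
  \<comment> \<open>The covariance hypothesis at time 1 with lag 0 is symmetric in the assets.
    Symmetry then reduces the case of a later first time to the ordered one.\<close>
  have sym: "\<rho> $ i $ j = \<rho> $ j $ i" for i j
    using cov'[of 0 1 i j] cov'[of 0 1 j i] by (simp add: mult.commute)
  have eB: "(LINT \<omega>|M. B i s \<omega> * B j t \<omega>) = min s t * \<rho> $ i $ j" if "0 \<le> s" "0 \<le> t" for i j s t
    using that cov'[of "t - s" s i j] cov'[of "s - t" t j i] sym[of i j]
    by (cases "s \<le> t") (auto simp: mult.commute)
  have YY: "Y s \<omega> * Y t \<omega> = (\<Sum>i\<in>UNIV. \<Sum>j\<in>UNIV. x $ i * \<sigma> $ i * (x $ j * \<sigma> $ j) * (B i s \<omega> * B j t \<omega>))" for s t \<omega>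
    by (simp add: Y_def sum_product mult_ac)
  have iYY: "integrable M (\<lambda>\<omega>. Y s \<omega> * Y t \<omega>)" if "0 \<le> s" "0 \<le> t" for s t
    unfolding YY using prod[OF that] by simp
  \<comment> \<open>The weights combine with the correlations into the quadratic form of
    \<open>Sigma_mat\<close>, so \<open>Y\<close> has the covariance of a Brownian motion with
    variance rate \<open>?q\<close>.\<close>
  have eYY: "(LINT \<omega>|M. Y s \<omega> * Y t \<omega>) = ?q * min s t" if "0 \<le> s" "0 \<le> t" for s t
    unfolding YY using that
    by (simp add: prod eB inner_vec_def matrix_vector_mult_def Sigma_mat_def sum_distrib_left
      sum_distrib_right mult_ac)
  have "(LINT \<omega>|M. (Lambda_cond \<tau> \<alpha> x \<sigma> \<rho> B \<omega>)\<^sup>2) \<noteq> 0"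
    unfolding Lambda using expectation_sum_increments_squared[of M Y ?q \<alpha> \<tau>] iYY eYY
      q min_kernel_pos[of \<tau> \<alpha>] \<alpha> by simp
  moreover have "(LINT \<omega>|M. Lambda_cond \<tau> \<alpha> x \<sigma> \<rho> B \<omega>) = 0"
    unfolding Lambda Y_def by (simp add: iB B2)
  moreover have "gaussian M (Lambda_cond \<tau> \<alpha> x \<sigma> \<rho> B)"
    unfolding Lambda Y_def using jointly_gaussian_sum_increments[OF jg] .
  ultimately show ?thesis
    by (intro gaussian_standardized[OF \<open>prob_space M\<close>])
qed

theorem lemma2p4:
  fixes M :: "'a measure"
    and \<tau> :: nat and \<alpha> :: "nat \<Rightarrow> real" and r p :: real
    and x \<mu> \<sigma> lam :: "real^'m::finite" and lam0 :: real
    and \<rho> :: "real^'m^'m"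
    and B :: "'m \<Rightarrow> real \<Rightarrow> 'a \<Rightarrow> real"
    and Z Zs :: "nat \<Rightarrow> 'm \<Rightarrow> nat \<Rightarrow> 'a \<Rightarrow> real"
    and h :: "'m \<Rightarrow> nat \<Rightarrow> real"
  assumes "prob_space M"
    and "\<tau> > 0"
    and "\<And>t. t < \<tau> \<Longrightarrow> \<alpha> t \<ge> 0"
    and "\<exists>t<\<tau>. \<alpha> t \<noteq> 0"
    and "r > 0"
    and "\<And>j. standard_brownian_motion M (B j)"
    and "jointly_gaussian M (\<lambda>(j, t). B j t) (UNIV \<times> {0..})"
    and "\<And>i j s t. 0 \<le> s \<Longrightarrow> 0 \<le> t \<Longrightarrow> covariance M (B i t) (B j (t + s)) = t * \<rho> $ i $ j"
    and "\<And>j. \<sigma> $ j > 0"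
    and "x \<bullet> (Sigma_mat \<sigma> \<rho> *v x) > 0"
    and "lam0 \<ge> 0" and "\<And>j. lam $ j \<ge> 0"
    and "\<And>k j l. k \<ge> 1 \<Longrightarrow> l \<in> {0, 1} \<Longrightarrow> Z k j l \<in> borel_measurable M"
    and "\<And>k j l. k \<ge> 1 \<Longrightarrow> l \<in> {0, 1} \<Longrightarrow> integrable M (\<lambda>\<omega>. exp (Z k j l \<omega>))"
    and "\<And>k j l. k \<ge> 1 \<Longrightarrow> l \<in> {0, 1} \<Longrightarrow> h j l = (LINT \<omega>|M. exp (Z k j l \<omega>)) - 1"
    and "\<And>k j l. k \<ge> 1 \<Longrightarrow> l \<in> {0, 1} \<Longrightarrow> Zs k j l \<in> borel_measurable M"
    and "\<And>k j l. k \<ge> 1 \<Longrightarrow> l \<in> {0, 1} \<Longrightarrow>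
           AE \<omega> in M. exp (Zs k j l \<omega>) - 1 = x $ j * (exp (Z k j l \<omega>) - 1)"
    and "0 < p" and "p < 1"
  shows "CVaR M (1 - p) (\<lambda>\<omega>. - W_L M \<tau> \<alpha> r \<mu> x \<sigma> \<rho> lam0 lam h Zs B \<omega>) =
           - c5 M \<tau> \<alpha> r lam0 lam Zs
           - c6 \<tau> \<alpha> * ((drift_vec r \<mu> lam0 lam h - r *\<^sub>R 1) \<bullet> x)
           + c7 \<tau> \<alpha> * (x \<bullet> (Sigma_mat \<sigma> \<rho> *v x))
           + c9 \<tau> \<alpha> p * sqrt (x \<bullet> (Sigma_mat \<sigma> \<rho> *v x))"
proof -
  interpret prob_space M by fact
  let ?q = "x \<bullet> (Sigma_mat \<sigma> \<rho> *v x)"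
  let ?N = "\<lambda>\<omega>. Lambda_cond \<tau> \<alpha> x \<sigma> \<rho> B \<omega> / std_dev M (Lambda_cond \<tau> \<alpha> x \<sigma> \<rho> B)"
  define a where "a = - c5 M \<tau> \<alpha> r lam0 lam Zs
    - c6 \<tau> \<alpha> * ((drift_vec r \<mu> lam0 lam h - r *\<^sub>R 1) \<bullet> x) + c7 \<tau> \<alpha> * ?q"
  define b where "b = c8 \<tau> \<alpha> * sqrt ?q"
  have b: "b > 0"
    unfolding b_def using c8_pos[of \<tau> \<alpha>] assms(3,4,10) by simp
  have "distributed M lborel ?N (\<lambda>x. ennreal (std_normal_density x))"
    using assms(1,3,4,6-8,10) by (intro Lambda_cond_standardized)
  \<comment> \<open>The loss is the negative of wealth, hence the slope \<open>- b\<close>; the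
    standard deviation is its absolute value \<open>b\<close>.\<close>
  then have "distributed M lborel (\<lambda>\<omega>. a + - b * ?N \<omega>) (normal_density (a + - b * 0) (\<bar>- b\<bar> * 1))"
    using b by (intro normal_density_affine) auto
  moreover have "(\<lambda>\<omega>. - W_L M \<tau> \<alpha> r \<mu> x \<sigma> \<rho> lam0 lam h Zs B \<omega>) = (\<lambda>\<omega>. a + - b * ?N \<omega>)"
    unfolding W_L_def a_def b_def by (simp add: fun_eq_iff)
  ultimately have D: "distributed M lborel (\<lambda>\<omega>. - W_L M \<tau> \<alpha> r \<mu> x \<sigma> \<rho> lam0 lam h Zs B \<omega>)
      (normal_density a b)"
    using b by simp
  show ?thesis
    using CVaR_normal[OF assms(1) b D assms(18,19)] by (simp add: a_def b_def c9_def)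
qed

end
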